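(* Let $m,k$ be integers with $2\leq k<m$, and let $F=\{D_I\}_{I\in\binom{[m]}{k}}$ be a family of positive real numbers. Suppose there exist $a_1,\ldots,a_{k+1}\in[m]$ such that $$(k-1)D_{a_1,\ldots,a_k}=\sum_{j=1}^{k}D_{a_1,\ldots,\hat a_j,\ldots,a_{k+1}},$$ where $D_{a_1,\ldots,\hat a_j,\ldots,a_{k+1}}$ denotes $D_{\{a_1,\ldots,a_{k+1}\}\setminus\{a_j\}}$. Define the family $F_1=F\cup\{D_{a_i,a_j}\}_{1\leq i<j\leq k+1}$ by $$D_{a_i,a_{k+1}}=D_{a_1,\ldots,a_k}-D_{a_1,\ldots,\hat a_i,\ldots,a_{k+1}}\quad (i\in[k]),$$ $$D_{a_i,a_j}=2D_{a_1,\ldots,a_k}-D_{a_1,\ldots,\hat a_i,\ldots,a_{k+1}}-D_{a_1,\ldots,\hat a_j,\ldots,a_{k+1}}\quad (1\leq i<j\leq k).$$ Then $F$ is positive-treelike if and only if $F_1$ is positive-treelike, and moreover $F$ and $F_1$ are realized by exactly the same positive-weighted trees.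
   Context: All trees are finite. A positive-weighted tree $\mathcal{T}=(T,w)$ is a tree with $w:E(T)\to(0,\infty)$. For vertices $i_1,\ldots,i_r$, the $r$-weight $D_{i_1,\ldots,i_r}(\mathcal{T})$ is the minimum total weight of a connected subtree of $T$ containing $i_1,\ldots,i_r$. A labeled tree has all leaves labeled and possibly some non-leaf vertices labeled (labels from $[m]=\{1,\ldots,m\}$, each used once); it is reduced if every degree-$2$ vertex is labeled. A family of positive numbers indexed by subsets of $[m]$ (here $k$-subsets, and for $F_1$ also some $2$-subsets) is positive-treelike if there exists a labeled reduced positive-weighted tree $\mathcal{T}$ with labels $[m]$ such that each number $D_I$ of the family equals the weight $D_I(\mathcal{T})$ computed on the vertices carrying the labels in $I$; such $\mathcal{T}$ realizes the family. *)

theory Defs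
  imports Complex_Main
begin

text \<open>
  Finite simple undirected graphs are given by a vertex set and a set of edges, each edge
  being a two-element set of vertices.
\<close>

definition simple_graph :: "'v set \<Rightarrow> 'v set set \<Rightarrow> bool" where
  "simple_graph V E \<longleftrightarrow> finite V \<and> (\<forall>e\<in>E. e \<subseteq> V \<and> card e = 2)"

definition connected_graph :: "'v set \<Rightarrow> 'v set set \<Rightarrow> bool" where
  "connected_graph V E \<longleftrightarrow>
     V \<noteq> {} \<and> (\<forall>u\<in>V. \<forall>v\<in>V. (u, v) \<in> {(x, y). {x, y} \<in> E}\<^sup>*)"

definition graph_cycle :: "'v set set \<Rightarrow> 'v list \<Rightarrow> bool" where
  "graph_cycle E vs \<longleftrightarrow>
     3 \<le> length vs \<and> distinct vs \<and>
     (\<forall>i<length vs. {vs ! i, vs ! (Suc i mod length vs)} \<in> E)"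

definition tree :: "'v set \<Rightarrow> 'v set set \<Rightarrow> bool" where
  "tree V E \<longleftrightarrow> simple_graph V E \<and> connected_graph V E \<and> (\<nexists>vs. graph_cycle E vs)"

definition degree :: "'v set set \<Rightarrow> 'v \<Rightarrow> nat" where
  "degree E v = card {e \<in> E. v \<in> e}"

text \<open>
  A weighted tree with labels: the vertex carrying the label \<open>i\<close> is \<open>lab T i\<close>. Weights of
  non-edges and labels outside \<open>{1..m}\<close> are irrelevant.
\<close>

record 'v labeled_tree =
  verts :: "'v set"
  edges :: "'v set set"
  weight :: "'v set \<Rightarrow> real"
  lab :: "nat \<Rightarrow> 'v"

definition positive_weighted_tree :: "'v labeled_tree \<Rightarrow> bool" where
  "positive_weighted_tree T \<longleftrightarrow>
     tree (verts T) (edges T) \<and> (\<forall>e\<in>edges T. 0 < weight T e)"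

definition labeled :: "nat \<Rightarrow> 'v labeled_tree \<Rightarrow> bool" where
  "labeled m T \<longleftrightarrow>
     inj_on (lab T) {1..m} \<and> lab T ` {1..m} \<subseteq> verts T \<and>
     (\<forall>v\<in>verts T. degree (edges T) v = 1 \<longrightarrow> v \<in> lab T ` {1..m})"

definition reduced :: "nat \<Rightarrow> 'v labeled_tree \<Rightarrow> bool" where
  "reduced m T \<longleftrightarrow>
     (\<forall>v\<in>verts T. degree (edges T) v = 2 \<longrightarrow> v \<in> lab T ` {1..m})"

text \<open>
  For a finite tree and a set of its vertices, the minimum below is over a finite nonempty set.
\<close>

definition r_weight :: "'v labeled_tree \<Rightarrow> 'v set \<Rightarrow> real" where
  "r_weight T S = Min {\<Sum>e\<in>E'. weight T e | V' E'.
     V' \<subseteq> verts T \<and> E' \<subseteq> edges T \<and> tree V' E' \<and> S \<subseteq> V'}"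

text \<open>
  A family of numbers indexed by sets of labels is represented by its set of pairs (index, value).
\<close>

type_synonym family = "(nat set \<times> real) set"

definition realizes :: "nat \<Rightarrow> 'v labeled_tree \<Rightarrow> family \<Rightarrow> bool" where
  "realizes m T F \<longleftrightarrow>
     positive_weighted_tree T \<and> labeled m T \<and> reduced m T \<and>
     (\<forall>(I, d)\<in>F. d = r_weight T (lab T ` I))"

text \<open>
  Every finite tree is isomorphic to one whose vertices are natural numbers, so it is no
  restriction to let the existential quantifier range over trees on vertices of type \<open>nat\<close>.
\<close>

definition positive_treelike :: "nat \<Rightarrow> family \<Rightarrow> bool" where
  "positive_treelike m F \<longleftrightarrow>
     (\<forall>(I, d)\<in>F. 0 < d) \<and> (\<exists>T :: nat labeled_tree. realizes m T F)"

definition subset_family :: "nat \<Rightarrow> nat \<Rightarrow> (nat set \<Rightarrow> real) \<Rightarrow> family" where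
  "subset_family m k D = {(I, D I) | I. I \<subseteq> {1..m} \<and> card I = k}"

text \<open>
  For \<open>k = 2\<close> the added pairs are already indices of \<open>subset_family m k D\<close>; under the relation
  assumed on \<open>a\<close> in the theorem the added values are then the ones already present.
\<close>

definition extended_family ::
    "nat \<Rightarrow> nat \<Rightarrow> (nat set \<Rightarrow> real) \<Rightarrow> (nat \<Rightarrow> nat) \<Rightarrow> family" where
  "extended_family m k D a =
     subset_family m k D
     \<union> {({a i, a (k + 1)}, D (a ` {1..k}) - D (a ` {1..k+1} - {a i})) | i. i \<in> {1..k}}
     \<union> {({a i, a j},
          2 * D (a ` {1..k}) - D (a ` {1..k+1} - {a i}) - D (a ` {1..k+1} - {a j}))
         | i j. 1 \<le> i \<and> i < j \<and> j \<le> k}"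

end

theory Submission
  imports Defs
begin

text \<open>
  The weight of the minimal subtree spanning \<open>S\<close> is the total weight of the edges whose removal
  separates two points of \<open>S\<close>. Let \<open>s\<close> be the number of labels among \<open>a\<^sub>1, \<dots>, a\<^sub>k\<close> that an edge
  \<open>e\<close> cuts off from \<open>c = a\<^sub>k\<^sub>+\<^sub>1\<close>. Then \<open>e\<close> contributes to the right-hand side minus the
  left-hand side of the hypothesis \<open>0\<close> if \<open>s \<le> 1\<close>, \<open>1\<close> if \<open>1 < s < k\<close>, and \<open>k\<close> if \<open>s = k\<close>,
  times its weight. As weights are positive, the hypothesis forces \<open>s \<le> 1\<close> for all edges: the
  subtree spanned by the \<open>a\<^sub>i\<close> is a star of paths centred at \<open>c\<close>, in which the formulas for the
  2-weights hold edge by edge.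
\<close>

section \<open>Connectivity and bridges in trees\<close>

definition linked :: "'v set set \<Rightarrow> ('v \<times> 'v) set" where
  "linked E = {(x, y). {x, y} \<in> E}\<^sup>*"

lemma linked_refl [simp]: "(x, x) \<in> linked E"
  by (simp add: linked_def)

lemma linked_trans: "(x, y) \<in> linked E \<Longrightarrow> (y, z) \<in> linked E \<Longrightarrow> (x, z) \<in> linked E"
  unfolding linked_def by (rule rtrancl_trans)

lemma linked_sym: "(x, y) \<in> linked E \<Longrightarrow> (y, x) \<in> linked E"
proof -
  have "sym {(x, y). {x, y} \<in> E}"
    by (auto intro!: symI simp: insert_commute)
  then show "(x, y) \<in> linked E \<Longrightarrow> (y, x) \<in> linked E"
    unfolding linked_def by (meson sym_rtrancl symD)
qed

lemma linked_edge: "{x, y} \<in> E \<Longrightarrow> (x, y) \<in> linked E"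
  unfolding linked_def by auto

lemma linked_mono: "(x, y) \<in> linked E \<Longrightarrow> E \<subseteq> E' \<Longrightarrow> (x, y) \<in> linked E'"
  unfolding linked_def by (rule subsetD[OF rtrancl_mono]) auto

text \<open>Induction along a walk from \<open>u\<close>. A step across \<open>{x, y}\<close> starts
  at one end and stops at the other, so one of the three alternatives holds again, possibly with a
  trivial link at the far end. It expresses that deleting one edge leaves a component in at most two
  pieces.\<close>

lemma linked_remove_edge:
  assumes "(u, v) \<in> linked E"
  shows "(u, v) \<in> linked (E - {{x, y}}) \<or>
    (u, x) \<in> linked (E - {{x, y}}) \<and> (y, v) \<in> linked (E - {{x, y}}) \<or>
    (u, y) \<in> linked (E - {{x, y}}) \<and> (x, v) \<in> linked (E - {{x, y}})"
  using assms unfolding linked_def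
proof (induction rule: rtrancl_induct)
  case base
  then show ?case by simp
next
  case (step v w)
  show ?case
  proof (cases "{v, w} = {x, y}")
    case True
    then have "v = x \<and> w = y \<or> v = y \<and> w = x"
      by (auto simp: doubleton_eq_iff)
    with step.IH show ?thesis by auto
  next
    case False
    with step.hyps(2) have "(v, w) \<in> {(p, q). {p, q} \<in> E - {{x, y}}}"
      by auto
    with step.IH show ?thesis
      by (meson rtrancl.rtrancl_into_rtrancl)
  qed
qed

text \<open>Loop erasure makes the vertices distinct, as \<open>graph_cycle\<close> demands of a
  cycle.\<close>

lemma linked_obtain_path:
  assumes "(x, y) \<in> linked E"
  obtains p where "p \<noteq> []" "hd p = x" "last p = y" "distinct p"
    "successively (\<lambda>u v. {u, v} \<in> E) p"
proof -
  have "\<exists>p. p \<noteq> [] \<and> hd p = x \<and> last p = y \<and> distinct p \<and> successively (\<lambda>u v. {u, v} \<in> E) p"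
    using assms unfolding linked_def
  proof (induction rule: rtrancl_induct)
    case base
    then show ?case by (intro exI[of _ "[x]"]) simp
  next
    case (step y z)
    then obtain p where p: "p \<noteq> []" "hd p = x" "last p = y" "distinct p"
      "successively (\<lambda>u v. {u, v} \<in> E) p" by blast
    show ?case
    proof (cases "z \<in> set p")
      case True
      \<comment> \<open>The walk returns to \<open>z\<close>: cut the path back to its occurrence of
        \<open>z\<close>.\<close>
      then obtain q r where "p = q @ z # r" by (meson split_list)
      with p show ?thesis
        by (intro exI[of _ "q @ [z]"]) (auto simp: successively_append_iff hd_append)
    next
      case False
      with p step.hyps(2) show ?thesis
        by (intro exI[of _ "p @ [z]"]) (auto simp: successively_append_iff)
    qed
  qed
  with that show thesis by blast
qed

text \<open>A simple path from \<open>x\<close> to \<open>y\<close> avoiding the edge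
  \<open>{x, y}\<close> would close up with that edge to a cycle.\<close>

lemma tree_edge_bridge:
  assumes "tree V E" and "{x, y} \<in> E"
  shows "(x, y) \<notin> linked (E - {{x, y}})"
proof
  assume "(x, y) \<in> linked (E - {{x, y}})"
  then obtain p where p: "p \<noteq> []" "hd p = x" "last p = y" "distinct p"
    and succ: "successively (\<lambda>u v. {u, v} \<in> E - {{x, y}}) p"
    by (rule linked_obtain_path)
  have "card {x, y} = 2"
    using assms unfolding tree_def simple_graph_def by blast
  then have "x \<noteq> y" by auto
  have first: "p ! 0 = x" and final: "p ! (length p - 1) = y"
    using p by (simp_all add: hd_conv_nth last_conv_nth)
  have step: "{p ! i, p ! Suc i} \<in> E - {{x, y}}" if "Suc i < length p" for i
    using succ that by (simp add: successively_conv_nth)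
  \<comment> \<open>A path with one vertex would give \<open>x = y\<close>, and one with two
    vertices would use the deleted edge.\<close>
  have "length p \<noteq> 1" using first final \<open>x \<noteq> y\<close> by auto
  moreover have "length p \<noteq> 2" using first final step[of 0] by (auto simp: numeral_2_eq_2)
  moreover have "length p \<noteq> 0" using p by simp
  ultimately have len: "3 \<le> length p" by linarith
  have "{p ! i, p ! (Suc i mod length p)} \<in> E" if "i < length p" for i
  proof (cases "Suc i < length p")
    case True
    then show ?thesis using step[of i] by simp
  next
    \<comment> \<open>The index wraps around here, and the closing edge is \<open>{x, y}\<close>
      itself.\<close>
    case False
    with that have "i = length p - 1" "Suc i = length p" by auto
    then show ?thesis using first final assms(2) by (simp add: insert_commute)
  qed
  with len p have "graph_cycle E p" by (simp add: graph_cycle_def)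
  with assms(1) show False by (auto simp: tree_def)
qed

lemma tree_edgeE:
  assumes "tree V E" and "e \<in> E"
  obtains x y where "e = {x, y}"
  using assms unfolding tree_def simple_graph_def by (meson card_2_iff)

lemma tree_linked: "tree V E \<Longrightarrow> u \<in> V \<Longrightarrow> v \<in> V \<Longrightarrow> (u, v) \<in> linked E"
  unfolding tree_def connected_graph_def linked_def by blast

lemma tree_finite_edges: "tree V E \<Longrightarrow> finite E"
  unfolding tree_def simple_graph_def
  by (rule finite_subset[of _ "Pow V"]) auto

text \<open>If \<open>u\<close> and \<open>v\<close> were linked in \<open>E'\<close> only across
  \<open>e\<close>, they would be joined to opposite ends of \<open>e\<close> without using
  \<open>e\<close>. Being linked in \<open>E - {e}\<close>, they would then link these ends there,
  although \<open>e\<close> is a bridge.\<close>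

lemma tree_linked_remove_edge:
  assumes "tree V E" and "E' \<subseteq> E" and "e \<in> E"
    and "(u, v) \<in> linked E'" and "(u, v) \<in> linked (E - {e})"
  shows "(u, v) \<in> linked (E' - {e})"
proof -
  obtain x y where e: "e = {x, y}" using assms tree_edgeE by metis
  have mono: "(p, q) \<in> linked (E - {e})" if "(p, q) \<in> linked (E' - {e})" for p q
    using that by (rule linked_mono) (use assms in auto)
  have "(x, y) \<notin> linked (E - {e})"
    using tree_edge_bridge assms e by metis
  then show ?thesis
    using linked_remove_edge[OF assms(4), of x y] assms(5) mono
    unfolding e[symmetric] by (meson linked_sym linked_trans)
qed

text \<open>Edges that are individually dispensable for \<open>u\<close> and \<open>v\<close> can be
  deleted together, one after another. This relies on acyclicity: on a cycle each single edge is
  dispensable, but two together may not be.\<close>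

lemma tree_linked_remove_edges:
  assumes "tree V E" and "finite R" and "R \<subseteq> E" and "(u, v) \<in> linked E"
    and "\<And>e. e \<in> R \<Longrightarrow> (u, v) \<in> linked (E - {e})"
  shows "(u, v) \<in> linked (E - R)"
  using assms(2,3,5)
proof (induction R rule: finite_induct)
  case empty
  then show ?case using assms(4) by simp
next
  case (insert e R)
  have "(u, v) \<in> linked (E - R - {e})"
  proof (rule tree_linked_remove_edge[OF assms(1)])
    show "e \<in> E" using insert.prems(1) by blast
    show "(u, v) \<in> linked (E - R)" by (rule insert.IH) (use insert.prems in blast)+
    show "(u, v) \<in> linked (E - {e})" by (rule insert.prems(2)) blast
  qed blast
  then show ?case by (subst Diff_insert)
qed

section \<open>Separating edges and the minimal spanning subtree\<close>

text \<open>For a nonempty set \<open>S\<close> of vertices of a tree, this is the edge set of the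
  smallest subtree containing \<open>S\<close>.\<close>

definition separating_edges :: "'v set set \<Rightarrow> 'v set \<Rightarrow> 'v set set" where
  "separating_edges E S = {e \<in> E. \<exists>u\<in>S. \<exists>v\<in>S. (u, v) \<notin> linked (E - {e})}"

text \<open>Every other edge separates no two points of \<open>S\<close>, so all of them can be
  deleted together without disconnecting \<open>u\<close> from \<open>v\<close>.\<close>

lemma linked_separating_edges:
  assumes "tree V E" and "S \<subseteq> V" and "u \<in> S" and "v \<in> S"
  shows "(u, v) \<in> linked (separating_edges E S)"
proof -
  let ?R = "E - separating_edges E S"
  have "(u, v) \<in> linked (E - ?R)"
  proof (rule tree_linked_remove_edges[OF assms(1)])
    show "finite ?R" using tree_finite_edges[OF assms(1)] by simp
    show "(u, v) \<in> linked E" using assms by (blast intro: tree_linked)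
    show "(u, v) \<in> linked (E - {e})" if "e \<in> ?R" for e
      using that assms by (auto simp: separating_edges_def)
  qed auto
  moreover have "E - ?R = separating_edges E S"
    by (auto simp: separating_edges_def)
  ultimately show ?thesis by simp
qed

text \<open>Simplicity and acyclicity are inherited from the big tree, so the content is
  connectedness, shown by linking every vertex to a fixed \<open>s\<close> in \<open>S\<close>.
  Including \<open>S\<close> in the vertex set covers a singleton, which has no separating
  edges.\<close>

lemma tree_separating_edges:
  assumes "tree V E" and "S \<subseteq> V" and "S \<noteq> {}"
  shows "tree (S \<union> \<Union>(separating_edges E S)) (separating_edges E S)"
proof -
  let ?E' = "separating_edges E S"
  have sub: "?E' \<subseteq> E" by (auto simp: separating_edges_def)
  have sg: "simple_graph V E" using assms by (simp add: tree_def)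
  obtain s where s: "s \<in> S" using assms by blast
  have from_s: "(s, z) \<in> linked ?E'" if "z \<in> S \<union> \<Union>?E'" for z
  proof (cases "z \<in> S")
    case True
    then show ?thesis using linked_separating_edges assms s by metis
  next
    case False
    with that obtain e where e: "e \<in> ?E'" "z \<in> e" by blast
    then obtain x y where xy: "e = {x, y}" using sub assms tree_edgeE by (metis subsetD)
    obtain u v where uv: "u \<in> S" "v \<in> S" "(u, v) \<notin> linked (E - {e})"
      using e by (auto simp: separating_edges_def)
    have "(u, v) \<in> linked ?E'" using linked_separating_edges assms uv by metis
    \<comment> \<open>The link from \<open>u\<close> to \<open>v\<close> must cross
      \<open>e\<close>, so \<open>u\<close> reaches one end of \<open>e\<close> beforehand, and then
      either end by way of \<open>e\<close>.\<close>
    moreover have "(u, v) \<notin> linked (?E' - {e})"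
      using uv(3) linked_mono[of u v "?E' - {e}" "E - {e}"] sub by blast
    ultimately have "(u, x) \<in> linked (?E' - {e}) \<or> (u, y) \<in> linked (?E' - {e})"
      using linked_remove_edge[of u v ?E' x y] xy by blast
    then have "(u, x) \<in> linked ?E' \<or> (u, y) \<in> linked ?E'"
      by (meson Diff_subset linked_mono)
    moreover have "(x, y) \<in> linked ?E'" using e xy linked_edge by metis
    ultimately have "(u, z) \<in> linked ?E'"
      using e(2) xy by (auto intro: linked_trans linked_sym)
    moreover have "(s, u) \<in> linked ?E'" using linked_separating_edges assms s uv by metis
    ultimately show ?thesis by (rule linked_trans[rotated])
  qed
  have "connected_graph (S \<union> \<Union>?E') ?E'"
    unfolding connected_graph_def linked_def[symmetric]
  proof (intro conjI ballI)
    show "S \<union> \<Union>?E' \<noteq> {}" using s by blast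
  next
    fix u v assume "u \<in> S \<union> \<Union>?E'" "v \<in> S \<union> \<Union>?E'"
    then show "(u, v) \<in> linked ?E'"
      by (rule linked_trans[OF linked_sym[OF from_s] from_s])
  qed
  moreover have "simple_graph (S \<union> \<Union>?E') ?E'"
  proof -
    have "S \<union> \<Union>?E' \<subseteq> V" using sg sub assms unfolding simple_graph_def by blast
    then show ?thesis using sg sub unfolding simple_graph_def
      by (auto intro: finite_subset)
  qed
  moreover have "\<nexists>vs. graph_cycle ?E' vs"
    using assms(1) sub unfolding tree_def graph_cycle_def by (meson subsetD)
  ultimately show ?thesis by (simp add: tree_def)
qed

text \<open>A subtree containing \<open>S\<close> that missed a separating edge would link the
  points which that edge separates. So every competitor contains all these edges and, weights being
  positive, weighs at least as much; the separating edges themselves form a competitor.\<close>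

lemma r_weight_eq_sum_separating_edges:
  assumes "positive_weighted_tree T" and "S \<subseteq> verts T" and "S \<noteq> {}"
  shows "r_weight T S = (\<Sum>e\<in>separating_edges (edges T) S. weight T e)"
proof -
  let ?sep = "separating_edges (edges T) S"
  have t: "tree (verts T) (edges T)" and w: "\<And>e. e \<in> edges T \<Longrightarrow> 0 < weight T e"
    using assms by (auto simp: positive_weighted_tree_def)
  have fin: "finite (edges T)" using t by (rule tree_finite_edges)
  have sub: "?sep \<subseteq> edges T" by (auto simp: separating_edges_def)
  show ?thesis
    unfolding r_weight_def
  proof (rule Min_eqI)
    show "finite {\<Sum>e\<in>E'. weight T e | V' E'.
        V' \<subseteq> verts T \<and> E' \<subseteq> edges T \<and> tree V' E' \<and> S \<subseteq> V'}"
      by (rule finite_subset[of _ "sum (weight T) ` Pow (edges T)"]) (use fin in auto)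
  next
    fix d assume "d \<in> {\<Sum>e\<in>E'. weight T e | V' E'.
        V' \<subseteq> verts T \<and> E' \<subseteq> edges T \<and> tree V' E' \<and> S \<subseteq> V'}"
    then obtain V' E' where d: "d = (\<Sum>e\<in>E'. weight T e)"
      and E': "E' \<subseteq> edges T" "tree V' E'" "S \<subseteq> V'" by blast
    have "?sep \<subseteq> E'"
    proof (rule subsetI, rule ccontr)
      fix e assume e: "e \<in> ?sep" "e \<notin> E'"
      then obtain u v where uv: "u \<in> S" "v \<in> S" "(u, v) \<notin> linked (edges T - {e})"
        by (auto simp: separating_edges_def)
      have "(u, v) \<in> linked E'" using uv E' by (blast intro: tree_linked)
      then have "(u, v) \<in> linked (edges T - {e})"
        by (rule linked_mono) (use e E' in auto)
      with uv show False by simp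
    qed
    then show "(\<Sum>e\<in>?sep. weight T e) \<le> d"
      unfolding d using E'(1) fin w
      by (intro sum_mono2) (auto intro: finite_subset intro!: less_imp_le)
  next
    have "S \<union> \<Union>?sep \<subseteq> verts T"
      using t sub assms unfolding tree_def simple_graph_def by blast
    then show "(\<Sum>e\<in>?sep. weight T e) \<in> {\<Sum>e\<in>E'. weight T e | V' E'.
        V' \<subseteq> verts T \<and> E' \<subseteq> edges T \<and> tree V' E' \<and> S \<subseteq> V'}"
      using tree_separating_edges[OF t assms(2,3)] sub by blast
  qed
qed

text \<open>Distinct vertices cannot be linked by an empty edge set, so some edge of positive weight
  separates them.\<close>

lemma r_weight_pair_pos:
  assumes "positive_weighted_tree T" and "u \<in> verts T" and "v \<in> verts T" and "u \<noteq> v"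
  shows "0 < r_weight T {u, v}"
proof -
  let ?sep = "separating_edges (edges T) {u, v}"
  have t: "tree (verts T) (edges T)" and w: "\<And>e. e \<in> edges T \<Longrightarrow> 0 < weight T e"
    using assms by (auto simp: positive_weighted_tree_def)
  have "(u, v) \<in> linked ?sep"
    by (rule linked_separating_edges[OF t]) (use assms in auto)
  then have "?sep \<noteq> {}" using assms(4) by (auto simp: linked_def)
  moreover have "finite ?sep" "?sep \<subseteq> edges T"
    using tree_finite_edges[OF t] by (auto simp: separating_edges_def)
  ultimately have "0 < (\<Sum>e\<in>?sep. weight T e)"
    using w by (intro sum_pos) auto
  then show ?thesis
    using r_weight_eq_sum_separating_edges[of T "{u, v}"] assms by simp
qed

section \<open>Weights as sums of edge contributions\<close>

text \<open>A set of labels is cut by an edge iff the predicate \<open>Q\<close>, being on the side away from a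
  base point, is not constant on it.\<close>

definition splits :: "('a \<Rightarrow> bool) \<Rightarrow> 'a set \<Rightarrow> real" where
  "splits Q I = (if \<exists>i\<in>I. \<exists>j\<in>I. Q i \<noteq> Q j then 1 else 0)"

text \<open>Deleting \<open>e\<close> leaves only two sides, so two vertices both cut off from
  \<open>c\<close> lie on the same side. Separation is thus described by one predicate per
  edge.\<close>

lemma tree_edge_two_sides:
  assumes "tree V E" and "e \<in> E" and "c \<in> V" and "u \<in> V" and "v \<in> V"
  shows "(u, v) \<notin> linked (E - {e}) \<longleftrightarrow>
    ((c, u) \<notin> linked (E - {e})) \<noteq> ((c, v) \<notin> linked (E - {e}))"
proof -
  obtain x y where e: "e = {x, y}" using assms tree_edgeE by metis
  have "(c, u) \<in> linked E" "(c, v) \<in> linked E"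
    using assms tree_linked by metis+
  then show ?thesis
    using linked_remove_edge[of c u E x y] linked_remove_edge[of c v E x y]
    unfolding e[symmetric] by (meson linked_sym linked_trans)
qed

text \<open>All weights become sums over the same edge set with 0/1 coefficients, so linear
  relations among them can be studied edge by edge.\<close>

lemma r_weight_eq_sum_splits:
  assumes "positive_weighted_tree T" and "lab T ` I \<subseteq> verts T" and "I \<noteq> {}"
    and "c \<in> verts T"
  shows "r_weight T (lab T ` I) =
    (\<Sum>e\<in>edges T. weight T e * splits (\<lambda>i. (c, lab T i) \<notin> linked (edges T - {e})) I)"
proof -
  let ?Q = "\<lambda>e i. (c, lab T i) \<notin> linked (edges T - {e})"
  have t: "tree (verts T) (edges T)"
    using assms by (auto simp: positive_weighted_tree_def)
  have "separating_edges (edges T) (lab T ` I) =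
      {e \<in> edges T. \<exists>i\<in>I. \<exists>j\<in>I. ?Q e i \<noteq> ?Q e j}"
  proof -
    have "(lab T i, lab T j) \<notin> linked (edges T - {e}) \<longleftrightarrow> ?Q e i \<noteq> ?Q e j"
      if "e \<in> edges T" "i \<in> I" "j \<in> I" for e i j
      by (rule tree_edge_two_sides[OF t]) (use that assms in auto)
    then show ?thesis
      unfolding separating_edges_def by (intro Collect_cong conj_cong refl) simp
  qed
  then have "r_weight T (lab T ` I) =
      (\<Sum>e | e \<in> edges T \<and> (\<exists>i\<in>I. \<exists>j\<in>I. ?Q e i \<noteq> ?Q e j). weight T e)"
    using r_weight_eq_sum_separating_edges[of T "lab T ` I"] assms by simp
  also have "\<dots> = (\<Sum>e\<in>edges T. if \<exists>i\<in>I. \<exists>j\<in>I. ?Q e i \<noteq> ?Q e j then weight T e else 0)"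
    using tree_finite_edges[OF t] by (rule sum.inter_filter)
  also have "\<dots> = (\<Sum>e\<in>edges T. weight T e * splits (?Q e) I)"
  proof -
    have "(if P then x else 0) = x * (if P then 1 else 0)" for P and x :: real
      by simp
    then show ?thesis unfolding splits_def by (intro sum.cong refl)
  qed
  finally show ?thesis .
qed

section \<open>Counting at a single edge, and the resulting star\<close>

text \<open>Here \<open>Q\<close> marks the points cut off from \<open>c\<close>. With two marked
  points, every set on the right still contains a marked point besides \<open>c\<close>, so the sum
  is \<open>card X\<close> and the inequality is strict. With one marked point \<open>p\<close>, the
  \<open>card X - 1\<close> sets that keep \<open>p\<close> are split. With none, the left side
  vanishes.\<close>

lemma sum_splits_ge:
  assumes "finite X" and "c \<notin> X" and "2 \<le> card X" and "\<not> Q c"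
  shows "(real (card X) - 1) * splits Q X \<le> (\<Sum>x\<in>X. splits Q (insert c X - {x}))"
    and "(real (card X) - 1) * splits Q X = (\<Sum>x\<in>X. splits Q (insert c X - {x})) \<Longrightarrow>
      x \<in> X \<Longrightarrow> y \<in> X \<Longrightarrow> Q x \<Longrightarrow> Q y \<Longrightarrow> x = y"
proof -
  have le1: "splits Q X \<le> 1" by (simp add: splits_def)
  have many: "(\<Sum>x\<in>X. splits Q (insert c X - {x})) = real (card X)"
    if "x \<in> X" "y \<in> X" "Q x" "Q y" "x \<noteq> y" for x y
  proof -
    have "splits Q (insert c X - {z}) = 1" if "z \<in> X" for z
    proof -
      have "c \<in> insert c X - {z}" using that assms by auto
      moreover have "\<exists>p\<in>insert c X - {z}. Q p"
        using \<open>x \<in> X\<close> \<open>y \<in> X\<close> \<open>Q x\<close> \<open>Q y\<close> \<open>x \<noteq> y\<close> by (cases "z = x") auto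
      ultimately show ?thesis using assms(4) unfolding splits_def by (smt (verit))
    qed
    then show ?thesis by simp
  qed
  have bound: "(real (card X) - 1) * splits Q X \<le> real (card X) - 1"
    using le1 assms(3) by (simp add: mult_left_le)
  show "x \<in> X \<Longrightarrow> y \<in> X \<Longrightarrow> Q x \<Longrightarrow> Q y \<Longrightarrow> x = y"
    if "(real (card X) - 1) * splits Q X = (\<Sum>x\<in>X. splits Q (insert c X - {x}))"
    using that many[of x y] bound by linarith
  show "(real (card X) - 1) * splits Q X \<le> (\<Sum>x\<in>X. splits Q (insert c X - {x}))"
  proof (cases "\<exists>x\<in>X. \<exists>y\<in>X. Q x \<and> Q y \<and> x \<noteq> y")
    case True
    then obtain x y where "x \<in> X" "y \<in> X" "Q x" "Q y" "x \<noteq> y" by blast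
    then show ?thesis using many[of x y] bound by linarith
  next
    case unique: False
    show ?thesis
    proof (cases "\<exists>x\<in>X. Q x")
      case True
      then obtain p where p: "p \<in> X" "Q p" by blast
      have "splits Q (insert c X - {z}) = 1" if "z \<in> X - {p}" for z
      proof -
        have "c \<in> insert c X - {z}" "p \<in> insert c X - {z}" using that assms p by auto
        then show ?thesis using assms(4) p unfolding splits_def by (smt (verit))
      qed
      then have "(\<Sum>x\<in>X - {p}. splits Q (insert c X - {x})) = real (card (X - {p}))"
        by simp
      also have "\<dots> = real (card X) - 1"
        using p assms by (simp add: card_Diff_singleton of_nat_diff)
      \<comment> \<open>The term for \<open>p\<close> is restored; it is nonnegative.\<close>
      finally have "real (card X) - 1 \<le> (\<Sum>x\<in>X. splits Q (insert c X - {x}))"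
        using sum_mono2[of X "X - {p}" "\<lambda>x. splits Q (insert c X - {x})"] assms
        by (simp add: splits_def)
      with bound show ?thesis by linarith
    next
      case False
      then have "splits Q X = 0" by (auto simp: splits_def)
      then show ?thesis by (simp add: sum_nonneg splits_def)
    qed
  qed
qed

text \<open>With at most one marked point \<open>p\<close>, every term is explicit: omitting
  \<open>p\<close> gives 0, omitting another point gives 1, and a pair is split exactly when one of
  its members is \<open>p\<close>. With no marked point all terms are 0.\<close>

lemma splits_star:
  assumes "finite X" and "c \<notin> X" and "2 \<le> card X" and "\<not> Q c"
    and unique: "\<And>x y. x \<in> X \<Longrightarrow> y \<in> X \<Longrightarrow> Q x \<Longrightarrow> Q y \<Longrightarrow> x = y"
  shows "x \<in> X \<Longrightarrow> splits Q {x, c} = splits Q X - splits Q (insert c X - {x})"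
    and "x \<in> X \<Longrightarrow> y \<in> X \<Longrightarrow> x \<noteq> y \<Longrightarrow>
      splits Q {x, y} = 2 * splits Q X - splits Q (insert c X - {x}) - splits Q (insert c X - {y})"
proof -
  have base: "c \<in> insert c X - {z}" if "z \<in> X" for z
    using that assms(2) by auto
  have "(\<forall>x\<in>X. splits Q {x, c} = splits Q X - splits Q (insert c X - {x})) \<and>
    (\<forall>x\<in>X. \<forall>y\<in>X. x \<noteq> y \<longrightarrow> splits Q {x, y} =
      2 * splits Q X - splits Q (insert c X - {x}) - splits Q (insert c X - {y}))"
  proof (cases "\<exists>p\<in>X. Q p")
    case True
    then obtain p where p: "p \<in> X" "Q p" by blast
    have Q: "Q z \<longleftrightarrow> z = p" if "z \<in> insert c X" for z
      using that p unique[of z p] assms(2,4) by blast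
    \<comment> \<open>Having at least two points, \<open>X\<close> contains an unmarked one, so it
      is split.\<close>
    have "X \<noteq> {p}" using assms(3) by auto
    then obtain q where "q \<in> X" "q \<noteq> p" using p by blast
    then have total: "splits Q X = 1"
      using p Q[of q] unfolding splits_def by auto
    have rest: "splits Q (insert c X - {z}) = (if z = p then 0 else 1)" if "z \<in> X" for z
    proof (cases "z = p")
      case True
      then show ?thesis using Q by (simp add: splits_def)
    next
      case False
      then have "p \<in> insert c X - {z}" using p by auto
      then have "\<exists>i\<in>insert c X - {z}. \<exists>j\<in>insert c X - {z}. Q i \<noteq> Q j"
        using base[OF that] p(2) assms(4) by blast
      then show ?thesis using False by (simp add: splits_def)
    qed
    have pair: "splits Q {x, y} = (if (x = p) \<noteq> (y = p) then 1 else 0)"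
      if "x \<in> insert c X" "y \<in> insert c X" for x y
      using Q[OF that(1)] Q[OF that(2)] by (simp add: splits_def)
    show ?thesis using total rest pair p assms(2) by auto
  next
    case False
    then have "splits Q I = 0" if "I \<subseteq> insert c X" for I
      using that assms(4) unfolding splits_def by (smt (verit) insert_iff subsetD)
    then show ?thesis by (simp add: subset_insertI Diff_subset)
  qed
  then show "x \<in> X \<Longrightarrow> splits Q {x, c} = splits Q X - splits Q (insert c X - {x})"
    and "x \<in> X \<Longrightarrow> y \<in> X \<Longrightarrow> x \<noteq> y \<Longrightarrow>
      splits Q {x, y} = 2 * splits Q X - splits Q (insert c X - {x}) - splits Q (insert c X - {y})"
    by blast+
qed

text \<open>The hypothesis says that the edgewise inequalities of \<open>sum_splits_ge\<close>,
  summed with positive weights, add up to an equality. So each of them is an equality, every edge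
  cuts off at most one point of \<open>X\<close> from \<open>c\<close>, and
  \<open>splits_star\<close> can be summed over the edges.\<close>

lemma r_weight_star:
  assumes T: "positive_weighted_tree T" and V: "lab T ` insert c X \<subseteq> verts T"
    and X: "finite X" "c \<notin> X" "2 \<le> card X"
    and eq: "(real (card X) - 1) * r_weight T (lab T ` X) =
      (\<Sum>x\<in>X. r_weight T (lab T ` (insert c X - {x})))"
  shows "x \<in> X \<Longrightarrow> r_weight T (lab T ` {x, c}) =
      r_weight T (lab T ` X) - r_weight T (lab T ` (insert c X - {x}))"
    and "x \<in> X \<Longrightarrow> y \<in> X \<Longrightarrow> x \<noteq> y \<Longrightarrow> r_weight T (lab T ` {x, y}) =
      2 * r_weight T (lab T ` X) - r_weight T (lab T ` (insert c X - {x}))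
        - r_weight T (lab T ` (insert c X - {y}))"
proof -
  let ?Q = "\<lambda>e i. (lab T c, lab T i) \<notin> linked (edges T - {e})"
  let ?w = "weight T"
  have fin: "finite (edges T)" and w: "\<And>e. e \<in> edges T \<Longrightarrow> 0 < ?w e"
    using T by (auto simp: positive_weighted_tree_def intro: tree_finite_edges)
  have rw: "r_weight T (lab T ` I) = (\<Sum>e\<in>edges T. ?w e * splits (?Q e) I)"
    if "I \<subseteq> insert c X" "I \<noteq> {}" for I
    by (rule r_weight_eq_sum_splits[OF T]) (use that V in auto)
  have ne: "X \<noteq> {}" using X by auto
  have rw_X: "r_weight T (lab T ` X) = (\<Sum>e\<in>edges T. ?w e * splits (?Q e) X)"
    using ne by (intro rw) auto
  have rw_rest: "r_weight T (lab T ` (insert c X - {z})) =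
      (\<Sum>e\<in>edges T. ?w e * splits (?Q e) (insert c X - {z}))" if "z \<in> X" for z
    using that X by (intro rw) auto
  \<comment> \<open>\<open>g e\<close> is the excess of the right side over the left side of the
    counting inequality at \<open>e\<close>.\<close>
  define g where "g e = (\<Sum>x\<in>X. splits (?Q e) (insert c X - {x}))
      - (real (card X) - 1) * splits (?Q e) X" for e
  have g0: "0 \<le> g e" for e
    using sum_splits_ge(1)[OF X, of "?Q e"] by (simp add: g_def)
  have "(\<Sum>x\<in>X. r_weight T (lab T ` (insert c X - {x}))) =
      (\<Sum>x\<in>X. \<Sum>e\<in>edges T. ?w e * splits (?Q e) (insert c X - {x}))"
    by (intro sum.cong rw_rest refl)
  also have "\<dots> = (\<Sum>e\<in>edges T. ?w e * (\<Sum>x\<in>X. splits (?Q e) (insert c X - {x})))"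
    by (subst sum.swap) (simp add: sum_distrib_left)
  finally have "(\<Sum>e\<in>edges T. ?w e * (\<Sum>x\<in>X. splits (?Q e) (insert c X - {x}))) =
      (real (card X) - 1) * (\<Sum>e\<in>edges T. ?w e * splits (?Q e) X)"
    using eq rw_X by simp
  then have "(\<Sum>e\<in>edges T. ?w e * g e) = 0"
    by (simp add: g_def right_diff_distrib sum_subtractf sum_distrib_left mult.left_commute)
  then have "?w e * g e = 0" if "e \<in> edges T" for e
    using that fin w g0
    by (subst (asm) sum_nonneg_eq_0_iff) (auto intro!: mult_nonneg_nonneg less_imp_le[OF w])
  then have "g e = 0" if "e \<in> edges T" for e
    using that w by fastforce
  then have unique: "x = y" if "e \<in> edges T" "x \<in> X" "y \<in> X" "?Q e x" "?Q e y" for e x y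
    using sum_splits_ge(2)[OF X, of "?Q e" x y] that by (simp add: g_def)
  show "r_weight T (lab T ` {x, c}) =
      r_weight T (lab T ` X) - r_weight T (lab T ` (insert c X - {x}))" if x: "x \<in> X"
  proof -
    have "r_weight T (lab T ` {x, c}) = (\<Sum>e\<in>edges T. ?w e * splits (?Q e) {x, c})"
      using x by (intro rw) auto
    also have "\<dots> = (\<Sum>e\<in>edges T. ?w e * (splits (?Q e) X - splits (?Q e) (insert c X - {x})))"
    proof (rule sum.cong[OF refl])
      fix e assume "e \<in> edges T"
      then show "?w e * splits (?Q e) {x, c} =
          ?w e * (splits (?Q e) X - splits (?Q e) (insert c X - {x}))"
        using splits_star(1)[OF X, of "?Q e" x] unique x by simp
    qed
    finally show ?thesis
      unfolding rw_X rw_rest[OF x] by (simp add: right_diff_distrib sum_subtractf)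
  qed
  show "r_weight T (lab T ` {x, y}) =
      2 * r_weight T (lab T ` X) - r_weight T (lab T ` (insert c X - {x}))
        - r_weight T (lab T ` (insert c X - {y}))" if xy: "x \<in> X" "y \<in> X" "x \<noteq> y"
  proof -
    have "r_weight T (lab T ` {x, y}) = (\<Sum>e\<in>edges T. ?w e * splits (?Q e) {x, y})"
      using xy by (intro rw) auto
    also have "\<dots> = (\<Sum>e\<in>edges T. ?w e * (2 * splits (?Q e) X
        - splits (?Q e) (insert c X - {x}) - splits (?Q e) (insert c X - {y})))"
    proof (rule sum.cong[OF refl])
      fix e assume "e \<in> edges T"
      then show "?w e * splits (?Q e) {x, y} = ?w e * (2 * splits (?Q e) X
          - splits (?Q e) (insert c X - {x}) - splits (?Q e) (insert c X - {y}))"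
        using splits_star(2)[OF X, of "?Q e" x y] unique xy by simp
    qed
    finally show ?thesis
      unfolding rw_X rw_rest[OF xy(1)] rw_rest[OF xy(2)]
      by (simp add: right_diff_distrib sum_subtractf sum_distrib_left mult.left_commute)
  qed
qed

section \<open>Transfer to families and positivity\<close>

text \<open>The larger family contains the smaller, which gives one direction. For the other, a
  realizing tree turns the relation on \<open>D\<close> into one on weights, and
  \<open>r_weight_star\<close> yields the added values.\<close>

lemma realizes_extended_family_iff:
  fixes T :: "'v labeled_tree"
  assumes "2 \<le> k" and "a ` {1..k+1} \<subseteq> {1..m}" and inj: "inj_on a {1..k+1}"
    and eq: "(real k - 1) * D (a ` {1..k}) = (\<Sum>j=1..k. D (a ` {1..k+1} - {a j}))"
  shows "realizes m T (subset_family m k D) \<longleftrightarrow> realizes m T (extended_family m k D a)"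
proof
  assume "realizes m T (extended_family m k D a)"
  then show "realizes m T (subset_family m k D)"
    by (auto simp: realizes_def extended_family_def)
next
  assume R: "realizes m T (subset_family m k D)"
  define X where "X = a ` {1..k}"
  define c where "c = a (k + 1)"
  have "{1..k+1} = insert (k + 1) {1..k}" by auto
  then have cX: "a ` {1..k+1} = insert c X" by (simp add: X_def c_def)
  have inj': "inj_on a {1..k}" using inj by (rule inj_on_subset) auto
  have X: "finite X" "c \<notin> X" "card X = k"
    using inj inj' by (auto simp: X_def c_def card_image dest: inj_onD)
  have sub: "insert c X \<subseteq> {1..m}" using assms(2) cX by simp
  have D: "D I = r_weight T (lab T ` I)" if "I \<subseteq> {1..m}" "card I = k" for I
    using R that unfolding realizes_def subset_family_def by auto
  have DX: "D X = r_weight T (lab T ` X)" using X sub by (intro D) auto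
  have Drest: "D (insert c X - {x}) = r_weight T (lab T ` (insert c X - {x}))" if "x \<in> X" for x
    using X sub that by (intro D) auto
  \<comment> \<open>Injectivity of \<open>a\<close> turns the sum over positions into a sum over
    labels.\<close>
  have "(\<Sum>j=1..k. D (a ` {1..k+1} - {a j})) = (\<Sum>x\<in>X. D (insert c X - {x}))"
    unfolding X_def cX[unfolded X_def] by (subst sum.reindex[OF inj']) simp
  also have "\<dots> = (\<Sum>x\<in>X. r_weight T (lab T ` (insert c X - {x})))"
    by (intro sum.cong refl Drest)
  finally have eq': "(real (card X) - 1) * r_weight T (lab T ` X) =
      (\<Sum>x\<in>X. r_weight T (lab T ` (insert c X - {x})))"
    using eq DX X by (simp add: X_def)
  have T: "positive_weighted_tree T" and "labeled m T"
    using R by (auto simp: realizes_def)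
  then have V: "lab T ` insert c X \<subseteq> verts T"
    using sub unfolding labeled_def by blast
  have two: "2 \<le> card X" using X assms(1) by simp
  note star = r_weight_star[OF T V X(1,2) two eq']
  have pair1: "D (a ` {1..k}) - D (a ` {1..k+1} - {a i}) = r_weight T (lab T ` {a i, a (k + 1)})"
    if "i \<in> {1..k}" for i
  proof -
    have "a i \<in> X" using that by (auto simp: X_def)
    then show ?thesis
      using star(1)[of "a i"] DX Drest[of "a i"] unfolding cX X_def[symmetric] c_def[symmetric]
      by simp
  qed
  have pair2: "2 * D (a ` {1..k}) - D (a ` {1..k+1} - {a i}) - D (a ` {1..k+1} - {a j}) =
      r_weight T (lab T ` {a i, a j})" if "1 \<le> i" "i < j" "j \<le> k" for i j
  proof -
    have "a i \<in> X" "a j \<in> X" using that by (auto simp: X_def)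
    moreover have "a i \<noteq> a j" using inj' that by (auto dest: inj_onD)
    ultimately show ?thesis
      using star(2)[of "a i" "a j"] DX Drest[of "a i"] Drest[of "a j"]
      unfolding cX X_def[symmetric] by simp
  qed
  have "\<forall>(I, d)\<in>extended_family m k D a. d = r_weight T (lab T ` I)"
    using R pair1 pair2 unfolding extended_family_def realizes_def by blast
  with R show "realizes m T (extended_family m k D a)"
    by (simp add: realizes_def)
qed

text \<open>The added values are differences, whose sign is not clear from positivity of
  \<open>D\<close>; a realizing tree supplies it.\<close>

lemma realizes_pair_pos:
  assumes "realizes m T F" and "({i, j}, d) \<in> F" and "i \<in> {1..m}" and "j \<in> {1..m}" and "i \<noteq> j"
  shows "0 < d"
proof -
  have T: "positive_weighted_tree T" and L: "labeled m T" and "d = r_weight T (lab T ` {i, j})"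
    using assms by (auto simp: realizes_def)
  moreover have "lab T i \<noteq> lab T j" "lab T i \<in> verts T" "lab T j \<in> verts T"
    using L assms unfolding labeled_def by (auto dest: inj_onD)
  ultimately show ?thesis using r_weight_pair_pos[OF T] by simp
qed

theorem mainTheorem3:
  fixes m k :: nat and D :: "nat set \<Rightarrow> real" and a :: "nat \<Rightarrow> nat"
  assumes "2 \<le> k" and "k < m"
    and "\<And>I. I \<subseteq> {1..m} \<Longrightarrow> card I = k \<Longrightarrow> 0 < D I"
    and "a ` {1..k+1} \<subseteq> {1..m}" and "inj_on a {1..k+1}"
    and "(real k - 1) * D (a ` {1..k}) = (\<Sum>j=1..k. D (a ` {1..k+1} - {a j}))"
  shows "(positive_treelike m (subset_family m k D) \<longleftrightarrow>
            positive_treelike m (extended_family m k D a)) \<and>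
         (\<forall>T :: 'v labeled_tree.
            realizes m T (subset_family m k D) \<longleftrightarrow> realizes m T (extended_family m k D a))"
proof -
  \<comment> \<open>This is polymorphic in the vertex type: it serves both the trees over
    \<open>nat\<close> in \<open>positive_treelike\<close> and those over \<open>'v\<close>.\<close>
  note same = realizes_extended_family_iff[OF assms(1,4-6)]
  have pos: "0 < d"
    if R: "realizes m T (extended_family m k D a)" and Id: "(I, d) \<in> extended_family m k D a"
    for T :: "nat labeled_tree" and I d
  proof -
    consider "(I, d) \<in> subset_family m k D"
      | i where "i \<in> {1..k}" "I = {a i, a (k + 1)}"
      | i j where "1 \<le> i" "i < j" "j \<le> k" "I = {a i, a j}"
      using Id unfolding extended_family_def by blast
    \<comment> \<open>Both kinds of added pairs are merged into one case, since only distinctness of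
      the positions matters for positivity.\<close>
    then consider "(I, d) \<in> subset_family m k D"
      | i j where "i \<in> {1..k+1}" "j \<in> {1..k+1}" "i \<noteq> j" "I = {a i, a j}"
    proof cases
      case (2 i)
      with that(2)[of i "k + 1"] show ?thesis by auto
    next
      case (3 i j)
      with that(2)[of i j] show ?thesis by auto
    qed (rule that(1))
    then show "0 < d"
    proof cases
      case 1
      then show ?thesis using assms(3) unfolding subset_family_def by blast
    next
      case (2 i j)
      have "a i \<in> {1..m}" "a j \<in> {1..m}" using 2 assms(4) by blast+
      moreover have "a i \<noteq> a j" using 2 inj_onD[OF assms(5)] by blast
      ultimately show ?thesis
        using realizes_pair_pos[OF R] Id 2(4) by blast
    qed
  qed
  have "\<forall>(I, d)\<in>subset_family m k D. 0 < d"
    using assms(3) unfolding subset_family_def by blast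
  then have "positive_treelike m (subset_family m k D) \<longleftrightarrow>
      positive_treelike m (extended_family m k D a)"
    using same pos unfolding positive_treelike_def by blast
  with same show ?thesis by blast
qed

end
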